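(* Let $\rho>\sqrt2$ and $\alpha=\arcsin(1/\rho)$. Among the algorithms $\mathrm{1RB}_\beta$, $\beta\in[0,\pi/2-\alpha)$, for $\mathrm{SRD}^\rho$, the expected rendezvous time is minimized by $\overline\beta=\max\left(0,\ \arccos\left(\tfrac34\right)-\arcsin(1/\rho)\right)$, in which case the algorithm is $\dfrac{3\sqrt{\rho^2-1}+\sqrt7}{4}$-competitive and $\delta$-effective with $\delta\approx 4.88813$.
   Context: Symmetric Rendezvous in a Disk. Two robots start on a circle centred at a known reference point $O$; both know $O$, the radius and their initial distance, but not which of the two possible positions on the circle at that distance is the peer's. Robots move with speed at most $1$, run the same synchronized randomized algorithm with independent random bits, and meet (rendezvous) only when at the same point at the same time. In $\mathrm{SRD}^\rho$ ($\rho>\sqrt2$) the circle has radius $\rho$ and the initial distance is $2$; in $\mathrm{SRD}_\alpha$ ($0<\alpha<\pi/4$) the circle is the unit circle and the robots are at angular distance $2\alpha$. These are equivalent under scaling by $1/\sin\alpha$, with $\rho=1/\sin\alpha$. The competitive ratio is the expected rendezvous time divided by the offline optimum ($1$ in $\mathrm{SRD}^\rho$, $\sin\alpha$ in $\mathrm{SRD}_\alpha$); $c$-competitive means competitive ratio $c$. A family of algorithms indexed by $\rho$ is $\delta$-effective if $\delta$ is the largest $\rho$ for which its expected rendezvous time in $\mathrm{SRD}^\rho$ is at most $4.25$. Darting move (described in $\mathrm{SRD}_\alpha$; the same in $\mathrm{SRD}^\rho$ after scaling): for a robot at point $A$ with $|OA|=r>0$, a rotational direction (clockwise or counterclockwise)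 and an angle $\theta\in[0,\pi/2)$, a $\theta$-darting in that direction means: let $L$ be the ray from $O$ obtained by rotating ray $OA$ by angle $\alpha$ in that direction; the robot walks in a straight line from $A$ to the point $P\in L$ with $\angle OAP=\theta$ (so $P=O$ if $\theta=0$, and $P$ is the midpoint of the chord subtending angle $2\alpha$ if $\theta=\pi/2-\alpha$). A random $\theta$-darting uses a direction chosen by an independent fair coin. Algorithm $\mathrm{1RB}_\beta$: each robot performs a random $\beta$-darting; then, if it has not met its peer, it walks straight to $O$.
   Formalization: The competitive ratio (3√(ρ²−1)+√7)/4 is asserted only when arcsin(1/ρ) ≤ arccos(3/4), i.e. ρ ≥ 4/√7; for √2 < ρ < 4/√7 the stated formula is false (ρ = 1.45 gives 1.45, not 1.44894) and the correct ratio ρ is asserted. *)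

theory Defs
  imports "HOL-Probability.Probability"
begin

text \<open>
  The plane is \<^typ>\<open>complex\<close>, with the reference point \<open>O\<close> at \<open>0\<close>.  In a placement for
  \<open>SRD\<close> with radius \<open>\<rho>\<close>, the two robots start at \<open>A\<close> and \<open>B\<close>; the half-angle
  between them is \<open>\<alpha> = arcsin (1 / \<rho>)\<close>.
\<close>

definition srd_placement :: "real \<Rightarrow> complex \<Rightarrow> complex \<Rightarrow> bool" where
  "srd_placement \<rho> A B \<longleftrightarrow> cmod A = \<rho> \<and> cmod B = \<rho> \<and> dist A B = 2"

text \<open>
  An algorithm draws random bits and maps a starting point and those bits to the
  trajectory followed as long as the peer has not been met.  What would happen after a
  meeting is irrelevant, since only the first meeting time matters.
\<close>

record 'r algorithm =
  bits :: "'r pmf"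
  trajectory :: "complex \<Rightarrow> 'r \<Rightarrow> real \<Rightarrow> complex"

text \<open>The infimum is \<open>\<infinity>\<close> if the robots never meet.\<close>

definition rendezvous_time :: "(real \<Rightarrow> complex) \<Rightarrow> (real \<Rightarrow> complex) \<Rightarrow> ennreal" where
  "rendezvous_time x y = (INF t\<in>{t. 0 \<le> t \<and> x t = y t}. ennreal t)"

definition expected_rendezvous_time :: "'r algorithm \<Rightarrow> complex \<Rightarrow> complex \<Rightarrow> ennreal" where
  "expected_rendezvous_time alg A B =
     (\<integral>\<^sup>+ (u, v). rendezvous_time (trajectory alg A u) (trajectory alg B v)
        \<partial>measure_pmf (pair_pmf (bits alg) (bits alg)))"

text \<open>
  Robots that know each other's position meet at the midpoint of their starting points, so
  the offline optimum is half their initial distance, i.e. \<open>1\<close> for an \<^const>\<open>srd_placement\<close>.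
\<close>

definition competitive_ratio :: "'r algorithm \<Rightarrow> complex \<Rightarrow> complex \<Rightarrow> ennreal" where
  "competitive_ratio alg A B = expected_rendezvous_time alg A B / ennreal (dist A B / 2)"

definition competitive :: "real \<Rightarrow> real \<Rightarrow> 'r algorithm \<Rightarrow> bool" where
  "competitive \<rho> c alg \<longleftrightarrow>
     (\<forall>A B. srd_placement \<rho> A B \<longrightarrow> competitive_ratio alg A B = ennreal c)"

definition effective :: "(real \<Rightarrow> 'r algorithm) \<Rightarrow> real \<Rightarrow> bool" where
  "effective alg \<delta> \<longleftrightarrow>
     (let S = {\<rho>. sqrt 2 < \<rho> \<and>
                  (\<forall>A B. srd_placement \<rho> A B \<longrightarrow>
                         expected_rendezvous_time (alg \<rho>) A B \<le> ennreal 4.25)}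
      in \<delta> \<in> S \<and> (\<forall>\<rho>\<in>S. \<rho> \<le> \<delta>))"

text \<open>
  The unoriented angle at the vertex \<open>Y\<close>; only used with \<open>X \<noteq> Y\<close> and \<open>Z \<noteq> Y\<close>.
\<close>

definition angle_at :: "complex \<Rightarrow> complex \<Rightarrow> complex \<Rightarrow> real" where
  "angle_at X Y Z = arccos (((X - Y) \<bullet> (Z - Y)) / (norm (X - Y) * norm (Z - Y)))"

definition rotated_ray :: "real \<Rightarrow> bool \<Rightarrow> complex \<Rightarrow> complex set" where
  "rotated_ray \<alpha> ccw A =
     {of_real s * cis (if ccw then \<alpha> else - \<alpha>) * A | s. 0 \<le> s}"

text \<open>
  Endpoint of a \<open>\<theta>\<close>-darting from \<open>A\<close>.  As \<open>P\<close> moves outwards along the ray, the angle at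
  \<open>A\<close> increases strictly from \<open>0\<close> at \<open>P = 0\<close> towards \<open>pi - \<alpha>\<close>, so \<open>P\<close> is unique for
  \<open>A \<noteq> 0\<close>, \<open>0 < \<alpha> < pi / 4\<close> and \<open>0 \<le> \<theta> < pi / 2\<close>.
\<close>

definition dart_point :: "real \<Rightarrow> real \<Rightarrow> bool \<Rightarrow> complex \<Rightarrow> complex" where
  "dart_point \<alpha> \<theta> ccw A = (THE P. P \<in> rotated_ray \<alpha> ccw A \<and> angle_at 0 A P = \<theta>)"

text \<open>Polygonal path at unit speed; the walker then stays at the last point.\<close>

fun walk :: "complex list \<Rightarrow> real \<Rightarrow> complex" where
  "walk [] t = 0"
| "walk [P] t = P"
| "walk (P # Q # Ps) t =
     (if t \<le> dist P Q then P + (t / dist P Q) *\<^sub>R (Q - P)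
      else walk (Q # Ps) (t - dist P Q))"

definition one_RB :: "real \<Rightarrow> real \<Rightarrow> bool algorithm" where
  "one_RB \<rho> \<beta> =
     \<lparr> bits = bernoulli_pmf (1 / 2),
       trajectory = (\<lambda>A ccw. walk [A, dart_point (arcsin (1 / \<rho>)) \<beta> ccw A, 0]) \<rparr>"

definition beta_bar :: "real \<Rightarrow> real" where
  "beta_bar \<rho> = max 0 (arccos (3 / 4) - arcsin (1 / \<rho>))"

end

theory Submission
  imports Defs
begin

text \<open>
  By the law of sines a \<open>\<beta>\<close>-darting lasts \<open>d = 1 / sin (\<alpha> + \<beta>)\<close> and the return to \<open>O\<close> lasts
  \<open>e = \<rho> sin \<beta> / sin (\<alpha> + \<beta>)\<close>.  With equal directions the two trajectories differ by the rotation
  by \<open>2\<alpha>\<close>, so the robots meet only at \<open>O\<close>; with different ones they are mirror images in the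
  bisector of the starting points, so the robots meet when they reach it: at time \<open>d\<close> if they
  dart towards each other, at \<open>O\<close> otherwise.  The expected time is therefore \<open>d + 3 e / 4\<close>, that
  is \<open>3/4 cot \<alpha> + (1 - 3/4 cos \<gamma>) / sin \<gamma>\<close> with \<open>\<gamma> = \<alpha> + \<beta>\<close>.  Since
  \<open>1 - 3/4 cos \<gamma> - sqrt 7 / 4 sin \<gamma> = 1 - cos (\<gamma> - arccos (3/4))\<close>, the second summand is least
  at \<open>\<gamma> = arccos (3/4)\<close>, and it increases beyond that point.
\<close>

section \<open>Geometry of a single darting\<close>

lemma inner_mult_left_complex: "(A * x) \<bullet> (A * y) = (cmod A)\<^sup>2 * (x \<bullet> y)" for A x y :: complex
  unfolding cmod_power2 by (simp add: inner_complex_def power2_eq_square algebra_simps)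

text \<open>Multiplication by \<open>A\<close> is a similarity, so the angle is the one at 1 in the
  triangle with vertices 0, 1 and \<open>p\<close>. Every dart can thus be computed from the start
  1.\<close>

lemma angle_at_scale:
  assumes "A \<noteq> 0"
  shows "angle_at 0 A (A * p) = arccos ((1 - Re p) / cmod (1 - p))"
proof -
  have "(0 - A) \<bullet> (A * p - A) = (A * (- 1)) \<bullet> (A * (p - 1))"
    by (simp add: algebra_simps)
  also have "\<dots> = (cmod A)\<^sup>2 * (1 - Re p)"
    by (simp only: inner_mult_left_complex) (simp add: inner_complex_def)
  finally have 1: "(0 - A) \<bullet> (A * p - A) = (cmod A)\<^sup>2 * (1 - Re p)" .
  have "norm (A * p - A) = cmod A * cmod (1 - p)"
    by (metis mult.right_neutral norm_minus_commute norm_mult right_diff_distrib)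
  then show ?thesis
    using assms unfolding angle_at_def 1 by (simp add: power2_eq_square)
qed

text \<open>The angle fixes the polar form of \<open>z\<close>: its real part is
  \<open>cmod z * cos \<beta>\<close>, its imaginary part \<open>cmod z * sin \<beta>\<close> up to
  sign. Eliminating \<open>cmod z\<close> leaves
  \<open>s * sin (\<alpha> + \<beta>) = sin \<beta>\<close>.\<close>

lemma dart_radius_unique:
  fixes \<alpha> \<beta> s :: real
  assumes "0 < \<alpha>" "0 \<le> \<beta>" "\<alpha> + \<beta> < pi / 2" "0 \<le> s"
    and ang: "arccos ((1 - s * cos \<alpha>) / cmod (1 - of_real s * cis \<alpha>)) = \<beta>"
  shows "s = sin \<beta> / sin (\<alpha> + \<beta>)"
proof -
  have sa: "sin \<alpha> > 0" and sb: "sin \<beta> \<ge> 0" and sab: "sin (\<alpha> + \<beta>) > 0"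
    using assms by (auto intro!: sin_gt_zero sin_ge_zero)
  define z where "z = 1 - of_real s * cis \<alpha>"
  have re: "Re z = 1 - s * cos \<alpha>" and im: "Im z = - (s * sin \<alpha>)"
    by (simp_all add: z_def)
  have z0: "z \<noteq> 0"
  proof
    assume "z = 0"
    then have "s * sin \<alpha> = 0" "1 - s * cos \<alpha> = 0" using re im by auto
    then show False using sa by simp
  qed
  \<comment> \<open>\<open>cos\<close> undoes \<open>arccos\<close> only on [-1, 1].\<close>
  have "\<bar>Re z / cmod z\<bar> \<le> 1"
    using abs_Re_le_cmod[of z] z0 by (simp add: divide_le_eq)
  then have "cos \<beta> = Re z / cmod z"
    using ang cos_arccos_abs[of "Re z / cmod z"] unfolding re[symmetric] z_def[symmetric] by simp
  then have x: "Re z = cmod z * cos \<beta>" using z0 by simp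
  have "(Im z)\<^sup>2 = (cmod z)\<^sup>2 - (Re z)\<^sup>2" by (simp add: cmod_power2)
  also have "\<dots> = (cmod z * sin \<beta>)\<^sup>2"
    unfolding x power_mult_distrib cos_squared_eq by (simp add: algebra_simps)
  finally have "(s * sin \<alpha>)\<^sup>2 = (cmod z * sin \<beta>)\<^sup>2" by (simp add: im)
  then have y: "s * sin \<alpha> = cmod z * sin \<beta>"
    using sa sb \<open>0 \<le> s\<close> by (simp add: power2_eq_iff_nonneg)
  have "cmod z * (s * sin \<alpha> * cos \<beta>) = cmod z * (sin \<beta> * (1 - s * cos \<alpha>))"
    using x y re by simp
  then have "s * sin \<alpha> * cos \<beta> = sin \<beta> * (1 - s * cos \<alpha>)" using z0 by simp
  then have "s * sin (\<alpha> + \<beta>) = sin \<beta>" by (simp add: sin_add algebra_simps)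
  then show ?thesis using sab by (simp add: field_simps)
qed

text \<open>The triangle 0, 1, \<open>s * cis \<alpha>\<close> has angle \<alpha> at 0 and \<beta>
  at 1, so the sine of its third angle is \<open>sin (\<alpha> + \<beta>)\<close>. The proof writes
  \<open>1 - s * cis \<alpha>\<close> as \<open>?r * cis (- \<beta>)\<close>, coordinate by
  coordinate.\<close>

lemma dart_triangle:
  fixes \<alpha> \<beta> :: real
  assumes "0 < \<alpha>" "0 \<le> \<beta>" "\<alpha> + \<beta> < pi / 2"
  defines "s \<equiv> sin \<beta> / sin (\<alpha> + \<beta>)"
  shows "cmod (1 - of_real s * cis \<alpha>) = sin \<alpha> / sin (\<alpha> + \<beta>)"
    and "arccos ((1 - s * cos \<alpha>) / cmod (1 - of_real s * cis \<alpha>)) = \<beta>"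
proof -
  have sa: "sin \<alpha> > 0" and sb: "sin \<beta> \<ge> 0" and sab: "sin (\<alpha> + \<beta>) > 0"
    using assms by (auto intro!: sin_gt_zero sin_ge_zero)
  let ?r = "sin \<alpha> / sin (\<alpha> + \<beta>)"
  have re: "1 - s * cos \<alpha> = ?r * cos \<beta>"
    using sab by (simp add: s_def field_simps sin_add)
  have im: "s * sin \<alpha> = ?r * sin \<beta>"
    by (simp add: s_def)
  have "(cmod (1 - of_real s * cis \<alpha>))\<^sup>2 = (?r * cos \<beta>)\<^sup>2 + (?r * sin \<beta>)\<^sup>2"
    unfolding cmod_power2 re[symmetric] im[symmetric] by simp
  also have "\<dots> = ?r\<^sup>2"
    by (simp only: power_mult_distrib distrib_left[symmetric] sin_cos_squared_add2 mult_1_right)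
  finally show 1: "cmod (1 - of_real s * cis \<alpha>) = ?r"
    using sa sab by (simp add: power2_eq_iff_nonneg)
  show "arccos ((1 - s * cos \<alpha>) / cmod (1 - of_real s * cis \<alpha>)) = \<beta>"
    unfolding 1 re using sa sab assms by (simp add: arccos_cos)
qed

text \<open>Closed form of the dart point for a robot starting at 1; \<open>dart_point_eq\<close>
  puts it in place of the definite description.\<close>

definition dart_factor :: "real \<Rightarrow> real \<Rightarrow> bool \<Rightarrow> complex" where
  "dart_factor \<alpha> \<beta> ccw =
     of_real (sin \<beta> / sin (\<alpha> + \<beta>)) * cis (if ccw then \<alpha> else - \<alpha>)"

text \<open>The two directions give complex conjugates, so the length of a dart does not depend on
  its direction.\<close>

lemma cmod_dart_direction:
  "cmod (1 - of_real s * cis (if ccw then \<alpha> else - \<alpha>)) = cmod (1 - of_real s * cis \<alpha>)"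
  by (auto simp: cmod_def)

lemma dart_point_eq:
  assumes "0 < \<alpha>" "0 \<le> \<beta>" "\<alpha> + \<beta> < pi / 2" "A \<noteq> 0"
  shows "dart_point \<alpha> \<beta> ccw A = A * dart_factor \<alpha> \<beta> ccw"
  unfolding dart_point_def
proof (rule the_equality)
  let ?s = "sin \<beta> / sin (\<alpha> + \<beta>)" and ?c = "cis (if ccw then \<alpha> else - \<alpha>)"
  have rec: "Re (of_real s * ?c) = s * cos \<alpha>" for s by simp
  have "0 \<le> ?s" using assms by (auto intro!: divide_nonneg_nonneg sin_ge_zero)
  then have "A * dart_factor \<alpha> \<beta> ccw \<in> rotated_ray \<alpha> ccw A"
    unfolding rotated_ray_def dart_factor_def
    by (intro CollectI exI[of _ ?s]) (simp add: mult_ac)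
  moreover have "angle_at 0 A (A * dart_factor \<alpha> \<beta> ccw) = \<beta>"
    unfolding angle_at_scale[OF \<open>A \<noteq> 0\<close>] dart_factor_def rec cmod_dart_direction
    using dart_triangle(2)[OF assms(1-3)] .
  ultimately show "A * dart_factor \<alpha> \<beta> ccw \<in> rotated_ray \<alpha> ccw A \<and>
      angle_at 0 A (A * dart_factor \<alpha> \<beta> ccw) = \<beta>" by blast
  fix P assume P: "P \<in> rotated_ray \<alpha> ccw A \<and> angle_at 0 A P = \<beta>"
  then obtain s where s: "0 \<le> s" "P = A * (of_real s * ?c)"
    unfolding rotated_ray_def by (auto simp: mult_ac)
  from P have "arccos ((1 - s * cos \<alpha>) / cmod (1 - of_real s * cis \<alpha>)) = \<beta>"
    unfolding s angle_at_scale[OF \<open>A \<noteq> 0\<close>] rec cmod_dart_direction by simp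
  from dart_radius_unique[OF assms(1-3) s(1) this]
  show "P = A * dart_factor \<alpha> \<beta> ccw" by (simp add: s(2) dart_factor_def)
qed

section \<open>Trajectories relative to the bisector\<close>

text \<open>
  A robot's trajectory is its starting point times a profile that depends only on its coin: \<open>d\<close>
  and \<open>e\<close> are the durations of the legs from \<open>1\<close> to \<open>p\<close> and from \<open>p\<close> to \<open>0\<close>.
\<close>

definition profile :: "real \<Rightarrow> real \<Rightarrow> complex \<Rightarrow> real \<Rightarrow> complex" where
  "profile d e p t =
     (if t \<le> d then 1 + (t / d) *\<^sub>R (p - 1)
      else if t - d \<le> e then (1 - (t - d) / e) *\<^sub>R p else 0)"

lemma profile_cnj: "profile d e (cnj p) t = cnj (profile d e p t)"
  by (simp add: profile_def scaleR_conv_of_real)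

lemma walk_eq_profile:
  assumes "cmod A * cmod (1 - p) = d" "cmod A * cmod p = e"
  shows "walk [A, A * p, 0] t = A * profile d e p t"
proof -
  have "dist A (A * p) = d"
    by (metis assms(1) dist_norm mult.right_neutral norm_mult right_diff_distrib)
  moreover have "dist (A * p) 0 = e" using assms by (simp add: norm_mult)
  ultimately show ?thesis
    by (simp add: profile_def algebra_simps scaleR_conv_of_real diff_divide_distrib)
qed

text \<open>If \<open>e = 0\<close>, the time \<open>d + e\<close> still belongs to the first leg,
  which ends at \<open>p\<close>; hence the last hypothesis.\<close>

lemma profile_end: "0 \<le> e \<Longrightarrow> d > 0 \<Longrightarrow> (e = 0 \<Longrightarrow> p = 0) \<Longrightarrow> profile d e p (d + e) = 0"
  by (auto simp: profile_def)

lemma profile_turn: "d > 0 \<Longrightarrow> profile d e p d = p"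
  by (simp add: profile_def)

text \<open>For a robot at 1 with its peer at \<open>cis (2 * \<alpha>)\<close>, the bisector has
  direction \<open>cis \<alpha>\<close>; rotating by -\<alpha> puts it on the real axis. A robot
  darting towards it stays strictly on its own side before time \<open>d\<close>.\<close>

lemma Im_profile_cis_neg:
  assumes "0 \<le> t" "t < d" "sin \<alpha> > 0"
  shows "Im (profile d e (of_real s * cis \<alpha>) t * cis (- \<alpha>)) < 0"
proof -
  have "Im (profile d e (of_real s * cis \<alpha>) t * cis (- \<alpha>)) = - ((1 - t / d) * sin \<alpha>)"
    using assms by (simp add: profile_def algebra_simps)
  then show ?thesis using assms by simp
qed

text \<open>Conjugated, this is the robot darting away from the bisector. The rotated path runs from
  \<open>cis \<alpha>\<close> via \<open>s * cis (2 * \<alpha>)\<close> to 0 and is in the open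
  upper half plane until it reaches 0.\<close>

lemma Im_profile_cis_pos:
  assumes "0 \<le> t" "t < d + e" "0 < d" "0 \<le> e" "0 \<le> s" "e > 0 \<Longrightarrow> s > 0"
    and "0 < sin \<alpha>" "0 < cos \<alpha>"
  shows "Im (profile d e (of_real s * cis \<alpha>) t * cis \<alpha>) > 0"
proof (cases "t \<le> d")
  case True
  have "Im (profile d e (of_real s * cis \<alpha>) t * cis \<alpha>)
      = (1 - t / d) * sin \<alpha> + 2 * (t / d) * s * sin \<alpha> * cos \<alpha>"
    using True by (simp add: profile_def algebra_simps)
  also have "\<dots> > 0"
  \<comment> \<open>At the turn the first summand vanishes. Positivity then comes from
    \<open>s > 0\<close>, since \<open>t < d + e\<close> forces a nonempty second leg.\<close>
  proof (cases "t = d")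
    case True
    then have "e > 0" using assms by simp
    then show ?thesis using True assms by simp
  next
    case False
    then have "(1 - t / d) * sin \<alpha> > 0" using \<open>t \<le> d\<close> assms by simp
    then show ?thesis using assms by (intro add_pos_nonneg) auto
  qed
  finally show ?thesis .
next
  case False
  then have "e > 0" "t - d < e" using assms by auto
  have "Im (profile d e (of_real s * cis \<alpha>) t * cis \<alpha>)
      = (1 - (t - d) / e) * (2 * s * sin \<alpha> * cos \<alpha>)"
    using False \<open>t - d < e\<close> by (simp add: profile_def algebra_simps)
  then show ?thesis using \<open>e > 0\<close> \<open>t - d < e\<close> assms by simp
qed

section \<open>Meeting times and their mean over two fair coins\<close>

lemma rendezvous_time_eqI:
  assumes "0 \<le> T" "x T = y T" "\<And>t. 0 \<le> t \<Longrightarrow> t < T \<Longrightarrow> x t \<noteq> y t"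
  shows "rendezvous_time x y = ennreal T"
  unfolding rendezvous_time_def
proof (rule antisym)
  show "(INF t\<in>{t. 0 \<le> t \<and> x t = y t}. ennreal t) \<le> ennreal T"
    using assms by (intro INF_lower) auto
  show "ennreal T \<le> (INF t\<in>{t. 0 \<le> t \<and> x t = y t}. ennreal t)"
    using assms by (intro INF_greatest ennreal_leI) (auto simp: not_less[symmetric])
qed

lemma rendezvous_time_commute: "rendezvous_time x y = rendezvous_time y x"
  unfolding rendezvous_time_def by (simp add: eq_commute)

lemma expected_rendezvous_time_fair:
  assumes "bits alg = bernoulli_pmf (1 / 2)"
    and "\<And>u v. rendezvous_time (trajectory alg A u) (trajectory alg B v) = ennreal (T u v)"
    and "\<And>u v. 0 \<le> T u v"
  shows "expected_rendezvous_time alg A B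
    = ennreal ((T True True + T True False + T False True + T False False) / 4)"
proof -
  have half: "ennreal a * ennreal (1 / 2) = ennreal (a / 2)" if "0 \<le> a" for a
    using that by (simp add: ennreal_mult[symmetric] del: ennreal_half)
  have "expected_rendezvous_time alg A B
      = (\<integral>\<^sup>+ u. (\<integral>\<^sup>+ v. ennreal (T u v) \<partial>bernoulli_pmf (1 / 2)) \<partial>bernoulli_pmf (1 / 2))"
    unfolding expected_rendezvous_time_def assms(1) by (simp add: nn_integral_pair_pmf' assms(2))
  also have "\<dots> = ennreal ((T True True + T True False + T False True + T False False) / 4)"
    using assms(3)
    by (simp add: nn_integral_bernoulli_pmf half ennreal_plus[symmetric] add_nonneg_nonneg
        del: ennreal_plus ennreal_half) (simp add: add_divide_distrib)
  finally show ?thesis .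
qed

section \<open>Meeting times of the algorithm for each pair of coins\<close>

lemma srd_angle:
  fixes \<rho> :: real
  assumes "\<rho> > sqrt 2"
  defines "\<alpha> \<equiv> arcsin (1 / \<rho>)"
  shows "0 < \<rho>" "0 < \<alpha>" "\<alpha> < pi / 4" "sin \<alpha> = 1 / \<rho>" "sin \<alpha> > 0" "cos \<alpha> > 0"
    "\<rho> * cos \<alpha> = sqrt (\<rho>\<^sup>2 - 1)"
proof -
  have r1: "\<rho> > 1" using assms real_sqrt_gt_1_iff[of 2] by linarith
  then show "0 < \<rho>" by simp
  show s: "sin \<alpha> = 1 / \<rho>" unfolding \<alpha>_def using r1
    by (intro sin_arcsin) (auto intro: order_trans[of "-1" 0])
  show "sin \<alpha> > 0" using s r1 by simp
  \<comment> \<open>The bound \<open>sqrt 2\<close> on the radius corresponds to the half-angle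
    \<open>pi / 4\<close>, whose sine is \<open>1 / sqrt 2\<close>.\<close>
  have "1 / \<rho> < 1 / sqrt 2" using assms r1 by (intro divide_strict_left_mono) auto
  moreover have "1 / sqrt 2 = sin (pi / 4)" by (simp add: sin_45 field_simps)
  ultimately have "1 / \<rho> < sin (pi / 4)" by (simp only:)
  then have "\<alpha> < arcsin (sin (pi / 4))" unfolding \<alpha>_def using r1
    by (intro arcsin_less_arcsin) (auto intro: order_trans[of "-1" 0])
  then show a: "\<alpha> < pi / 4" by (simp add: arcsin_sin)
  have "arcsin 0 < \<alpha>" unfolding \<alpha>_def using r1 by (intro arcsin_less_arcsin) auto
  then show a0: "0 < \<alpha>" by simp
  show c: "cos \<alpha> > 0" using a0 a by (intro cos_gt_zero) auto
  have "(\<rho> * cos \<alpha>)\<^sup>2 = \<rho>\<^sup>2 - 1"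
    unfolding power_mult_distrib cos_squared_eq s using r1 by (simp add: field_simps)
  then show "\<rho> * cos \<alpha> = sqrt (\<rho>\<^sup>2 - 1)"
    using c r1 by (intro real_sqrt_unique[symmetric]) auto
qed

lemma dart_factor_cnj: "dart_factor \<alpha> \<beta> False = cnj (dart_factor \<alpha> \<beta> True)"
  by (simp add: dart_factor_def cis_cnj)

lemma trajectory_one_RB:
  fixes \<rho> :: real
  defines "\<alpha> \<equiv> arcsin (1 / \<rho>)"
  assumes "\<rho> > sqrt 2" "0 \<le> \<beta>" "\<beta> < pi / 2 - \<alpha>" "cmod A = \<rho>"
  shows "trajectory (one_RB \<rho> \<beta>) A u t
    = A * profile (1 / sin (\<alpha> + \<beta>)) (\<rho> * (sin \<beta> / sin (\<alpha> + \<beta>))) (dart_factor \<alpha> \<beta> u) t"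
proof -
  note a = srd_angle[OF assms(2), folded \<alpha>_def]
  have sn: "0 \<le> sin \<beta> / sin (\<alpha> + \<beta>)"
    using assms a by (auto intro!: divide_nonneg_nonneg sin_ge_zero)
  have "dart_point \<alpha> \<beta> u A = A * dart_factor \<alpha> \<beta> u"
    using assms a by (intro dart_point_eq) auto
  \<comment> \<open>Scaling by \<rho> turns the numerator \<open>sin \<alpha>\<close> of the dart
    length into \<open>\<rho> * sin \<alpha> = 1\<close>.\<close>
  moreover have "cmod A * cmod (1 - dart_factor \<alpha> \<beta> u) = 1 / sin (\<alpha> + \<beta>)"
    unfolding dart_factor_def cmod_dart_direction
    using assms a by (subst dart_triangle(1)) auto
  moreover have "cmod A * cmod (dart_factor \<alpha> \<beta> u) = \<rho> * (sin \<beta> / sin (\<alpha> + \<beta>))"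
    using sn assms(5) unfolding dart_factor_def norm_mult norm_cis norm_of_real
    by (simp only: abs_of_nonneg mult_1_right)
  ultimately show ?thesis
    by (simp only: one_RB_def algorithm.simps \<alpha>_def[symmetric] walk_eq_profile)
qed

text \<open>The peer lies counterclockwise of \<open>A\<close>, so \<open>u \<and> \<not> v\<close>
  means darting towards each other. Divided by \<open>A\<close>, the positions are
  \<open>g t\<close> or its conjugate, the peer's turned by
  \<open>cis (2 * \<alpha>)\<close>.\<close>

lemma rendezvous_time_one_RB:
  fixes \<rho> \<beta> :: real
  defines "\<alpha> \<equiv> arcsin (1 / \<rho>)"
  defines "d \<equiv> 1 / sin (\<alpha> + \<beta>)" and "e \<equiv> \<rho> * (sin \<beta> / sin (\<alpha> + \<beta>))"
  assumes "\<rho> > sqrt 2" "0 \<le> \<beta>" "\<beta> < pi / 2 - \<alpha>" "cmod A = \<rho>"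
  shows "rendezvous_time (trajectory (one_RB \<rho> \<beta>) A u)
      (trajectory (one_RB \<rho> \<beta>) (A * cis (2 * \<alpha>)) v)
    = ennreal (if u \<and> \<not> v then d else d + e)"
proof -
  note a = srd_angle[OF assms(4), folded \<alpha>_def]
  define s where "s = sin \<beta> / sin (\<alpha> + \<beta>)"
  have sab: "sin (\<alpha> + \<beta>) > 0" using assms a by (auto intro!: sin_gt_zero)
  have s0: "0 \<le> s" unfolding s_def using assms a by (auto intro!: divide_nonneg_nonneg sin_ge_zero)
  have d0: "0 < d" using sab by (simp add: d_def)
  have e: "e = \<rho> * s" by (simp add: e_def s_def)
  then have e0: "0 \<le> e" and es: "e > 0 \<Longrightarrow> s > 0" and es': "e = 0 \<Longrightarrow> s = 0"
    using s0 a by (auto simp: zero_less_mult_iff)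
  define g where "g = profile d e (of_real s * cis \<alpha>)"
  have A0: "A \<noteq> 0" using a assms by auto
  have B: "cmod (A * cis (2 * \<alpha>)) = \<rho>" using assms by (simp add: norm_mult)
  have fT: "dart_factor \<alpha> \<beta> True = of_real s * cis \<alpha>"
    by (simp only: dart_factor_def s_def if_True)
  have f: "profile d e (dart_factor \<alpha> \<beta> w) t = (if w then g t else cnj (g t))" for w t
    by (cases w) (simp_all only: dart_factor_cnj fT g_def profile_cnj if_True if_False)
  have pos: "Im (g t * cis \<alpha>) > 0" if "0 \<le> t" "t < d + e" for t
    unfolding g_def using Im_profile_cis_pos[OF that d0 e0 s0 es a(5,6)] .
  have neg: "Im (g t * cis (- \<alpha>)) < 0" if "0 \<le> t" "t < d" for t
    unfolding g_def using Im_profile_cis_neg[OF that a(5)] .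
  have gend: "g (d + e) = 0" unfolding g_def using e0 d0 es' by (intro profile_end) auto
  have gturn: "g d = of_real s * cis \<alpha>" unfolding g_def using d0 by (rule profile_turn)
  have c2: "cis (2 * \<alpha>) = cis \<alpha> * cis \<alpha>" by (simp add: cis_mult)
  have c1: "cis \<alpha> * (cis \<alpha> * cis (- \<alpha>)) = cis \<alpha>" by (simp add: cis_mult)
  \<comment> \<open>The turning point lies on the bisector, so the reflection
    \<open>z \<mapsto> cis (2 * \<alpha>) * cnj z\<close> in it fixes that point.\<close>
  have gturn_eq: "g d = cis (2 * \<alpha>) * cnj (g d)"
    unfolding gturn c2 using c1 by (simp add: cis_cnj)
  have ne1: "cis (2 * \<alpha>) \<noteq> 1"
  proof
    assume "cis (2 * \<alpha>) = 1"
    then have "sin (2 * \<alpha>) = 0" by (simp add: complex_eq_iff)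
    then show False using a(5,6) by (simp add: sin_double)
  qed
  \<comment> \<open>A meeting of robots darting apart puts the conjugate of \<open>z\<close> on the
    bisector, against \<open>pos\<close>; likewise \<open>tc\<close> puts \<open>z\<close> there
    when they dart together, against \<open>neg\<close>.\<close>
  have ct: "cnj z = cis (2 * \<alpha>) * z \<Longrightarrow> Im (z * cis \<alpha>) = 0" for z
  proof -
    assume "cnj z = cis (2 * \<alpha>) * z"
    then have "cnj (z * cis \<alpha>) = z * cis \<alpha>"
      using arg_cong[OF cis_mult[of "2 * \<alpha>" "- \<alpha>"], of "\<lambda>w. w * z"]
      by (simp add: cis_cnj mult_ac)
    then show "Im (z * cis \<alpha>) = 0" by (simp only: complex_eq_iff) simp
  qed
  have tc: "z = cis (2 * \<alpha>) * cnj z \<Longrightarrow> Im (z * cis (- \<alpha>)) = 0" for z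
  proof -
    assume "z = cis (2 * \<alpha>) * cnj z"
    then have "z * cis (- \<alpha>) = cis (2 * \<alpha>) * cnj z * cis (- \<alpha>)" by simp
    also have "\<dots> = cnj z * cis \<alpha>"
      using arg_cong[OF cis_mult[of "2 * \<alpha>" "- \<alpha>"], of "\<lambda>w. w * cnj z"] by (simp add: mult_ac)
    finally have "cnj (z * cis (- \<alpha>)) = z * cis (- \<alpha>)" by (simp add: cis_cnj)
    then show "Im (z * cis (- \<alpha>)) = 0" by (simp only: complex_eq_iff) simp
  qed
  have eq: "trajectory (one_RB \<rho> \<beta>) A u t = trajectory (one_RB \<rho> \<beta>) (A * cis (2 * \<alpha>)) v t
      \<longleftrightarrow> (if u then g t else cnj (g t)) = cis (2 * \<alpha>) * (if v then g t else cnj (g t))" for t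
    using A0 trajectory_one_RB[OF assms(4,5), folded \<alpha>_def, OF assms(6,7), of u t]
      trajectory_one_RB[OF assms(4,5), folded \<alpha>_def, OF assms(6) B, of v t]
    unfolding d_def[symmetric] e_def[symmetric] f by (simp add: mult.assoc)
  show ?thesis
  proof (rule rendezvous_time_eqI, unfold eq)
    show "0 \<le> (if u \<and> \<not> v then d else d + e)" using d0 e0 by simp
    let ?T = "if u \<and> \<not> v then d else d + e"
    show "(if u then g ?T else cnj (g ?T)) = cis (2 * \<alpha>) * (if v then g ?T else cnj (g ?T))"
      using gturn_eq by (cases u; cases v) (simp_all add: gend)
    fix t assume t: "0 \<le> t" "t < (if u \<and> \<not> v then d else d + e)"
    then have "t < d + e" using e0 by (auto split: if_splits)
    from pos[OF t(1) this] have p: "Im (g t * cis \<alpha>) > 0" .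
    \<comment> \<open>With equal coins a meeting means that a nontrivial rotation fixes the
      position, which is possible only at 0.\<close>
    then have g0: "g t \<noteq> 0" by auto
    show "(if u then g t else cnj (g t)) \<noteq> cis (2 * \<alpha>) * (if v then g t else cnj (g t))"
      using p g0 ne1 ct[of "g t"] tc[of "g t"] neg[OF t(1)] t(2)
      by (cases u; cases v) auto
  qed
qed

section \<open>Placements and the expected time in closed form\<close>

text \<open>The quotient \<open>w\<close> of the two starts has modulus 1, and the distance 2 fixes
  its real part. This leaves two conjugate values, that is, the two orders of the robots on the
  circle.\<close>

lemma srd_placement_cases:
  assumes "\<rho> > sqrt 2" "srd_placement \<rho> A B"
  defines "\<alpha> \<equiv> arcsin (1 / \<rho>)"
  shows "B = A * cis (2 * \<alpha>) \<or> A = B * cis (2 * \<alpha>)"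
proof -
  note a = srd_angle[OF assms(1), folded \<alpha>_def]
  have n: "cmod A = \<rho>" "cmod B = \<rho>" "dist A B = 2" using assms by (auto simp: srd_placement_def)
  have A0: "A \<noteq> 0" using n a by auto
  define w where "w = B / A"
  have BA: "B = A * w" using A0 by (simp add: w_def)
  have w1: "cmod w = 1" using n a by (simp add: w_def norm_divide)
  have "\<rho> * cmod (1 - w) = 2"
    using n by (metis BA dist_norm mult.right_neutral norm_mult right_diff_distrib)
  then have "cmod (1 - w) = 2 * sin \<alpha>" unfolding a(4) using a(1) by (simp add: field_simps)
  then have "(1 - Re w)\<^sup>2 + (Im w)\<^sup>2 = 4 * (sin \<alpha>)\<^sup>2"
    using cmod_power2[of "1 - w"] by (simp add: power_mult_distrib)
  moreover have w2: "(Re w)\<^sup>2 + (Im w)\<^sup>2 = 1" using cmod_power2[of w] w1 by simp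
  ultimately have re: "Re w = cos (2 * \<alpha>)"
    unfolding cos_double_sin by (simp add: power2_eq_square algebra_simps)
  have "(Im w)\<^sup>2 = (sin (2 * \<alpha>))\<^sup>2" using w2 re by (simp add: sin_squared_eq)
  then have "Im w = sin (2 * \<alpha>) \<or> Im w = - sin (2 * \<alpha>)" by (simp add: power2_eq_iff)
  then have "w = cis (2 * \<alpha>) \<or> w = cis (- (2 * \<alpha>))" using re by (auto simp: complex_eq_iff)
  then show ?thesis unfolding BA by (auto simp: mult.assoc cis_mult)
qed

text \<open>Ensures that the quantification over placements in \<open>effective\<close> is not
  vacuous, so that it really bounds \<rho>.\<close>

lemma ex_srd_placement:
  assumes "\<rho> > sqrt 2"
  shows "\<exists>A B. srd_placement \<rho> A B"
proof (intro exI)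
  note a = srd_angle[OF assms]
  define \<alpha> where "\<alpha> = arcsin (1 / \<rho>)"
  have "cis (- \<alpha>) - cis \<alpha> = - (2 * \<i> * of_real (sin \<alpha>))" by (simp add: complex_eq_iff)
  then have "cmod (cis (- \<alpha>) - cis \<alpha>) = 2 * sin \<alpha>"
    using a(5)[folded \<alpha>_def] by (simp add: norm_mult)
  then have "\<rho> * cmod (cis (- \<alpha>) - cis \<alpha>) = 2" using a(1,4) by (simp add: \<alpha>_def)
  moreover have "dist (\<rho> *\<^sub>R cis (- \<alpha>)) (\<rho> *\<^sub>R cis \<alpha>) = \<bar>\<rho>\<bar> * cmod (cis (- \<alpha>) - cis \<alpha>)"
    by (simp add: dist_norm scaleR_diff_right[symmetric])
  ultimately show "srd_placement \<rho> (\<rho> *\<^sub>R cis (- \<alpha>)) (\<rho> *\<^sub>R cis \<alpha>)"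
    using a(1) by (simp add: srd_placement_def)
qed

lemma expected_rendezvous_time_one_RB:
  fixes \<rho> \<beta> :: real
  defines "\<alpha> \<equiv> arcsin (1 / \<rho>)"
  assumes "\<rho> > sqrt 2" "0 \<le> \<beta>" "\<beta> < pi / 2 - \<alpha>" "srd_placement \<rho> A B"
  shows "expected_rendezvous_time (one_RB \<rho> \<beta>) A B
    = ennreal (3 / 4 * sqrt (\<rho>\<^sup>2 - 1) + (1 - 3 / 4 * cos (\<alpha> + \<beta>)) / sin (\<alpha> + \<beta>))"
proof -
  note a = srd_angle[OF assms(2), folded \<alpha>_def]
  have n: "cmod A = \<rho>" "cmod B = \<rho>" using assms by (auto simp: srd_placement_def)
  define d where "d = 1 / sin (\<alpha> + \<beta>)"
  define e where "e = \<rho> * (sin \<beta> / sin (\<alpha> + \<beta>))"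
  have sab: "sin (\<alpha> + \<beta>) > 0" using assms a by (auto intro!: sin_gt_zero)
  have nn: "0 \<le> d" "0 \<le> e" unfolding d_def e_def
    using assms a sab by (auto intro!: mult_nonneg_nonneg divide_nonneg_nonneg sin_ge_zero)
  note rt = rendezvous_time_one_RB[OF assms(2,3), folded \<alpha>_def, OF assms(4), folded d_def e_def]
  have "expected_rendezvous_time (one_RB \<rho> \<beta>) A B = ennreal (d + 3 / 4 * e)"
    using srd_placement_cases[OF assms(2,5), folded \<alpha>_def]
  proof
    assume "B = A * cis (2 * \<alpha>)"
    then have "rendezvous_time (trajectory (one_RB \<rho> \<beta>) A u) (trajectory (one_RB \<rho> \<beta>) B v)
        = ennreal (if u \<and> \<not> v then d else d + e)" for u v
      using rt[OF n(1)] by simp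
    from expected_rendezvous_time_fair[OF _ this] nn show ?thesis
      by (simp add: one_RB_def field_simps)
  next
    assume "A = B * cis (2 * \<alpha>)"
    then have "rendezvous_time (trajectory (one_RB \<rho> \<beta>) A u) (trajectory (one_RB \<rho> \<beta>) B v)
        = ennreal (if v \<and> \<not> u then d else d + e)" for u v
      using rt[OF n(2)] by (simp add: rendezvous_time_commute)
    from expected_rendezvous_time_fair[OF _ this] nn show ?thesis
      by (simp add: one_RB_def field_simps)
  qed
  \<comment> \<open>Writing \<beta> as the difference of \<open>\<alpha> + \<beta>\<close> and
    \<alpha>, and using \<open>\<rho> * sin \<alpha> = 1\<close>, splits \<open>e\<close> into a
    constant minus the cotangent of \<open>\<alpha> + \<beta>\<close>.\<close>
  also have "sin \<beta> = sin (\<alpha> + \<beta>) * cos \<alpha> - cos (\<alpha> + \<beta>) * sin \<alpha>"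
    using sin_diff[of "\<alpha> + \<beta>" \<alpha>] by simp
  then have "e = \<rho> * cos \<alpha> - cos (\<alpha> + \<beta>) / sin (\<alpha> + \<beta>)"
    using sab a(1,4) by (simp add: e_def field_simps)
  then have "d + 3 / 4 * e
      = 3 / 4 * sqrt (\<rho>\<^sup>2 - 1) + (1 - 3 / 4 * cos (\<alpha> + \<beta>)) / sin (\<alpha> + \<beta>)"
    unfolding a(7)[symmetric] d_def by (simp add: diff_divide_distrib algebra_simps)
  finally show ?thesis .
qed

section \<open>Minimizing the cost over the dart angle\<close>

lemma sin_arccos_3_4: "sin (arccos (3 / 4)) = sqrt 7 / 4"
proof -
  have "sin (arccos (3 / 4)) = sqrt (7 / 16)"
    by (simp add: sin_arccos power2_eq_square)
  also have "\<dots> = sqrt 7 / 4" by (simp add: real_sqrt_divide)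
  finally show ?thesis .
qed

lemma arccos_3_4_bounds: "0 < arccos (3 / 4 :: real)" "arccos (3 / 4 :: real) < pi / 2"
proof -
  have "arccos (3 / 4) < arccos (0 :: real)" by (rule arccos_less_arccos) auto
  then show "arccos (3 / 4 :: real) < pi / 2" by simp
  have "arccos 1 < arccos (3 / 4 :: real)" by (rule arccos_less_arccos) auto
  then show "0 < arccos (3 / 4 :: real)" by simp
qed

lemma cost_lower_bound:
  assumes "0 < \<gamma>" "\<gamma> < pi / 2"
  shows "sqrt 7 / 4 \<le> (1 - 3 / 4 * cos \<gamma>) / sin \<gamma>"
proof -
  have "sin \<gamma> > 0" using assms by (intro sin_gt_zero) auto
  moreover have "cos (\<gamma> - arccos (3 / 4)) \<le> 1" by simp
  then have "3 / 4 * cos \<gamma> + sqrt 7 / 4 * sin \<gamma> \<le> 1"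
    by (simp add: cos_diff sin_arccos_3_4 mult.commute)
  ultimately show ?thesis by (simp add: le_divide_eq algebra_simps)
qed

text \<open>No derivative is taken. With \<open>\<gamma> = \<alpha> + 2 * h\<close>, the difference
  after cross-multiplication factors as
  \<open>2 * sin h * (3 / 4 * cos h - cos (\<alpha> + h))\<close>. Expanding
  \<open>cos (\<alpha> + h)\<close> and using \<open>cos \<alpha> \<le> 3 / 4\<close> shows that the
  bracket is nonnegative.\<close>

lemma cost_increasing:
  assumes "arccos (3 / 4) \<le> \<alpha>" "\<alpha> \<le> \<gamma>" "\<gamma> < pi / 2"
  shows "(1 - 3 / 4 * cos \<alpha>) / sin \<alpha> \<le> (1 - 3 / 4 * cos \<gamma>) / sin \<gamma>"
proof -
  have a0: "0 < \<alpha>" using assms arccos_3_4_bounds by linarith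
  then have s: "sin \<alpha> > 0" "sin \<gamma> > 0" using assms by (auto intro!: sin_gt_zero)
  define h where "h = (\<gamma> - \<alpha>) / 2"
  have g: "\<gamma> = \<alpha> + 2 * h" unfolding h_def by argo
  have m: "(\<gamma> + \<alpha>) / 2 = \<alpha> + h" unfolding h_def by argo
  have h: "0 \<le> h" "h < pi / 2" using assms a0 by (auto simp: h_def)
  have sh: "sin h \<ge> 0" "cos h \<ge> 0" using h by (auto intro!: sin_ge_zero cos_ge_zero)
  have "cos \<alpha> \<le> cos (arccos (3 / 4))"
    using assms a0 arccos_3_4_bounds by (intro cos_monotone_0_pi_le) auto
  then have "cos \<alpha> * cos h \<le> 3 / 4 * cos h" using sh by (intro mult_right_mono) auto
  then have "cos (\<alpha> + h) \<le> 3 / 4 * cos h" using s sh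
    using mult_nonneg_nonneg[of "sin \<alpha>" "sin h"] by (simp add: cos_add del: mult_nonneg_nonneg)
  then have "0 \<le> 2 * sin h * (3 / 4 * cos h - cos (\<alpha> + h))" using sh by simp
  also have "\<dots> = sin \<alpha> - sin \<gamma> + 3 / 4 * sin (\<gamma> - \<alpha>)"
    using sin_diff_sin[of \<gamma> \<alpha>, unfolded m, folded h_def] sin_double[of h]
    by (simp add: g algebra_simps)
  also have "\<dots> = sin \<alpha> * (1 - 3 / 4 * cos \<gamma>) - sin \<gamma> * (1 - 3 / 4 * cos \<alpha>)"
    by (simp add: sin_diff algebra_simps)
  finally show ?thesis using s by (simp add: divide_le_eq le_divide_eq field_simps)
qed

text \<open>The expected time at \<open>beta_bar \<rho>\<close>. In the second case, where \<rho> is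
  below \<open>4 / sqrt 7\<close>, the maximum in \<open>beta_bar\<close> is 0: both robots walk
  straight to the centre and meet there at time \<rho>.\<close>

definition optimal_time :: "real \<Rightarrow> real" where
  "optimal_time \<rho> =
     (if arcsin (1 / \<rho>) \<le> arccos (3 / 4) then (3 * sqrt (\<rho>\<^sup>2 - 1) + sqrt 7) / 4 else \<rho>)"

lemma beta_bar_range:
  assumes "\<rho> > sqrt 2"
  shows "0 \<le> beta_bar \<rho>" "beta_bar \<rho> < pi / 2 - arcsin (1 / \<rho>)"
  using srd_angle[OF assms] arccos_3_4_bounds by (auto simp: beta_bar_def)

lemma optimal_time_eq:
  assumes "\<rho> > sqrt 2"
  shows "optimal_time \<rho> = 3 / 4 * sqrt (\<rho>\<^sup>2 - 1) +
    (1 - 3 / 4 * cos (arcsin (1 / \<rho>) + beta_bar \<rho>)) / sin (arcsin (1 / \<rho>) + beta_bar \<rho>)"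
proof (cases "arcsin (1 / \<rho>) \<le> arccos (3 / 4)")
  case True
  then have "arcsin (1 / \<rho>) + beta_bar \<rho> = arccos (3 / 4)" by (simp add: beta_bar_def)
  then show ?thesis using True by (simp add: optimal_time_def sin_arccos_3_4 field_simps)
next
  case False
  note a = srd_angle[OF assms]
  \<comment> \<open>With dart angle 0 the cotangent terms cancel, leaving
    \<open>1 / sin \<alpha> = \<rho>\<close>.\<close>
  show ?thesis
    using False a(1) by (simp add: optimal_time_def beta_bar_def a(4) flip: a(7)) (simp add: algebra_simps)
qed

lemma expected_rendezvous_time_beta_bar:
  assumes "\<rho> > sqrt 2" "srd_placement \<rho> A B"
  shows "expected_rendezvous_time (one_RB \<rho> (beta_bar \<rho>)) A B = ennreal (optimal_time \<rho>)"
  using assms beta_bar_range expected_rendezvous_time_one_RB optimal_time_eq by simp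

lemma beta_bar_minimal:
  assumes "\<rho> > sqrt 2" "srd_placement \<rho> A B" "0 \<le> \<beta>" "\<beta> < pi / 2 - arcsin (1 / \<rho>)"
  shows "expected_rendezvous_time (one_RB \<rho> (beta_bar \<rho>)) A B
    \<le> expected_rendezvous_time (one_RB \<rho> \<beta>) A B"
proof -
  define \<alpha> where "\<alpha> = arcsin (1 / \<rho>)"
  note a = srd_angle[OF assms(1), folded \<alpha>_def]
  have "(1 - 3 / 4 * cos (\<alpha> + beta_bar \<rho>)) / sin (\<alpha> + beta_bar \<rho>)
      \<le> (1 - 3 / 4 * cos (\<alpha> + \<beta>)) / sin (\<alpha> + \<beta>)"
  proof (cases "\<alpha> \<le> arccos (3 / 4)")
    case True
    then have "\<alpha> + beta_bar \<rho> = arccos (3 / 4)" by (simp add: beta_bar_def \<alpha>_def)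
    then have "(1 - 3 / 4 * cos (\<alpha> + beta_bar \<rho>)) / sin (\<alpha> + beta_bar \<rho>) = sqrt 7 / 4"
      by (simp add: sin_arccos_3_4 field_simps)
    then show ?thesis
      using cost_lower_bound[of "\<alpha> + \<beta>"] assms(3,4) a(2) by (simp only: \<alpha>_def)
  next
    case False
    then show ?thesis using cost_increasing[of \<alpha> "\<alpha> + \<beta>"] assms
      by (simp add: beta_bar_def \<alpha>_def)
  qed
  then show ?thesis
    using assms beta_bar_range[OF assms(1)]
    by (simp add: expected_rendezvous_time_one_RB \<alpha>_def ennreal_leI)
qed

lemma competitive_beta_bar:
  assumes "\<rho> > sqrt 2"
  shows "competitive \<rho> (optimal_time \<rho>) (one_RB \<rho> (beta_bar \<rho>))"
  using assms unfolding competitive_def competitive_ratio_def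
  by (auto simp: expected_rendezvous_time_beta_bar) (simp add: srd_placement_def divide_ennreal_def)

section \<open>The largest radius with expected time at most 4.25\<close>

text \<open>The threshold solves \<open>3 * sqrt (\<rho>\<^sup>2 - 1) + sqrt 7 = 17\<close>. In the
  case of dart angle 0 both sides of the equivalence are true.\<close>

lemma optimal_time_le_iff:
  assumes "\<rho> > sqrt 2"
  shows "optimal_time \<rho> \<le> 4.25 \<longleftrightarrow> \<rho> \<le> sqrt (1 + ((17 - sqrt 7) / 3)\<^sup>2)"
proof -
  let ?c = "(17 - sqrt 7) / 3"
  note a = srd_angle[OF assms]
  have "sqrt 7 \<le> sqrt (3\<^sup>2)" by (subst real_sqrt_le_iff) simp
  then have s7: "sqrt 7 \<le> 3" by simp
  have c: "?c \<ge> 4" using s7 by simp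
  show ?thesis
  proof (cases "arcsin (1 / \<rho>) \<le> arccos (3 / 4)")
    case True
    have "optimal_time \<rho> \<le> 4.25 \<longleftrightarrow> sqrt (\<rho>\<^sup>2 - 1) \<le> ?c"

      unfolding optimal_time_def if_P[OF True] by (auto simp: power2_eq_square)
    also have "\<dots> \<longleftrightarrow> \<rho>\<^sup>2 - 1 \<le> ?c\<^sup>2"
      using real_sqrt_le_iff[of "\<rho>\<^sup>2 - 1" "?c\<^sup>2"] c by (simp add: real_sqrt_abs)
    also have "\<dots> \<longleftrightarrow> \<rho>\<^sup>2 \<le> 1 + ?c\<^sup>2" by linarith
    also have "\<dots> \<longleftrightarrow> \<rho> \<le> sqrt (1 + ?c\<^sup>2)"
      using real_sqrt_le_iff[of "\<rho>\<^sup>2" "1 + ?c\<^sup>2"] a(1) by (simp add: real_sqrt_abs)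
    finally show ?thesis .
  next
    case False
    \<comment> \<open>Taking sines turns the case condition into \<open>\<rho> < 4 / sqrt 7\<close>,
      hence \<open>\<rho> < 2\<close>, well below both bounds.\<close>
    have "sin (arccos (3 / 4)) < sin (arcsin (1 / \<rho>))"
      using False a arccos_3_4_bounds by (intro sin_monotone_2pi) auto
    then have "\<rho> * sqrt 7 < 4" using a(1) by (simp add: sin_arccos_3_4 a(4) field_simps)
    moreover have "2 \<le> sqrt 7" by (rule real_le_rsqrt) simp
    then have "\<rho> * 2 \<le> \<rho> * sqrt 7" using a(1) by (intro mult_left_mono) auto
    ultimately have "\<rho> < 2" by linarith
    moreover have "4 \<le> sqrt (1 + ?c\<^sup>2)"
      using power_mono[OF c, of 2] by (intro real_le_rsqrt) simp
    ultimately show ?thesis using False by (simp add: optimal_time_def)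
  qed
qed

lemma delta_approx: "\<bar>sqrt (1 + ((17 - sqrt 7) / 3)\<^sup>2) - 4.88813\<bar> < 0.000005"
proof -
  \<comment> \<open>This enclosure of \<open>sqrt 7\<close> is tight enough to place the threshold
    between 4.88813 and 4.888134.\<close>
  have s: "2.64575 < sqrt 7" "sqrt 7 < 2.645752"
    by (rule real_less_rsqrt real_less_lsqrt; simp add: power2_eq_square)+
  have "4.784749 < (17 - sqrt 7) / 3" "(17 - sqrt 7) / 3 < 4.78475"
    using s by auto
  then have "4.784749\<^sup>2 < ((17 - sqrt 7) / 3)\<^sup>2" "((17 - sqrt 7) / 3)\<^sup>2 < 4.78475\<^sup>2"
    by (intro power_strict_mono; simp)+
  then have "4.88813 < sqrt (1 + ((17 - sqrt 7) / 3)\<^sup>2)" "sqrt (1 + ((17 - sqrt 7) / 3)\<^sup>2) < 4.888134"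
    by (intro real_less_rsqrt real_less_lsqrt; simp add: power2_eq_square)+
  then show ?thesis by (simp add: abs_if)
qed

text \<open>The admissible radii above \<open>sqrt 2\<close> are exactly those up to
  \<open>?\<delta>\<close>. Since \<open>?\<delta>\<close> itself exceeds \<open>sqrt 2\<close>, it
  belongs to the set and is its maximum.\<close>

lemma effective_beta_bar:
  "effective (\<lambda>\<rho>. one_RB \<rho> (beta_bar \<rho>)) (sqrt (1 + ((17 - sqrt 7) / 3)\<^sup>2))"
proof -
  let ?\<delta> = "sqrt (1 + ((17 - sqrt 7) / 3)\<^sup>2)"
  have ot: "0 \<le> optimal_time \<rho>" if "\<rho> > sqrt 2" for \<rho>
    using srd_angle(1,6)[OF that]
    by (auto simp: optimal_time_def srd_angle(7)[OF that, symmetric]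
        intro!: add_nonneg_nonneg mult_nonneg_nonneg)
  have S: "(\<forall>A B. srd_placement \<rho> A B \<longrightarrow>
        expected_rendezvous_time (one_RB \<rho> (beta_bar \<rho>)) A B \<le> ennreal 4.25) \<longleftrightarrow> \<rho> \<le> ?\<delta>"
    if "sqrt 2 < \<rho>" for \<rho>
    using ex_srd_placement[OF that] ot[OF that] optimal_time_le_iff[OF that]
    by (auto simp: expected_rendezvous_time_beta_bar[OF that] ennreal_le_iff)
  have "sqrt 2 < 2" by (rule real_less_lsqrt) auto
  moreover have "4 < ?\<delta>"
    using delta_approx unfolding abs_less_iff
    by (elim conjE) (simp add: algebra_simps del: real_sqrt_less_iff)
  ultimately have "sqrt 2 < ?\<delta>" by linarith
  then show ?thesis unfolding effective_def Let_def using S by blast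
qed

theorem theorem3:
  shows "(\<forall>\<rho> > sqrt 2.
            (\<forall>A B. srd_placement \<rho> A B \<longrightarrow>
               is_arg_min (\<lambda>\<beta>. expected_rendezvous_time (one_RB \<rho> \<beta>) A B)
                 (\<lambda>\<beta>. \<beta> \<in> {0..<pi / 2 - arcsin (1 / \<rho>)}) (beta_bar \<rho>)) \<and>
            (arcsin (1 / \<rho>) \<le> arccos (3 / 4) \<longrightarrow>
               competitive \<rho> ((3 * sqrt (\<rho>\<^sup>2 - 1) + sqrt 7) / 4) (one_RB \<rho> (beta_bar \<rho>))) \<and>
            (arccos (3 / 4) < arcsin (1 / \<rho>) \<longrightarrow>
               competitive \<rho> \<rho> (one_RB \<rho> (beta_bar \<rho>)))) \<and>
         (\<exists>\<delta>. effective (\<lambda>\<rho>. one_RB \<rho> (beta_bar \<rho>)) \<delta> \<and> \<bar>\<delta> - 4.88813\<bar> < 0.000005)"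
proof (intro conjI allI impI)
  fix \<rho> :: real assume \<rho>: "\<rho> > sqrt 2"
  show "is_arg_min (\<lambda>\<beta>. expected_rendezvous_time (one_RB \<rho> \<beta>) A B)
      (\<lambda>\<beta>. \<beta> \<in> {0..<pi / 2 - arcsin (1 / \<rho>)}) (beta_bar \<rho>)" if "srd_placement \<rho> A B" for A B
    using beta_bar_range[OF \<rho>] beta_bar_minimal[OF \<rho> that]
    by (simp add: is_arg_min_def linorder_not_less) fastforce
  show "competitive \<rho> ((3 * sqrt (\<rho>\<^sup>2 - 1) + sqrt 7) / 4) (one_RB \<rho> (beta_bar \<rho>))"
    if "arcsin (1 / \<rho>) \<le> arccos (3 / 4)"
    using competitive_beta_bar[OF \<rho>] that by (simp add: optimal_time_def)
  show "competitive \<rho> \<rho> (one_RB \<rho> (beta_bar \<rho>))" if "arccos (3 / 4) < arcsin (1 / \<rho>)"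
    using competitive_beta_bar[OF \<rho>] that by (simp add: optimal_time_def)
next
  show "\<exists>\<delta>. effective (\<lambda>\<rho>. one_RB \<rho> (beta_bar \<rho>)) \<delta> \<and> \<bar>\<delta> - 4.88813\<bar> < 0.000005"
    using effective_beta_bar delta_approx by blast
qed

end
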